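(* Let $n>2k\ge6$. Let $(S_1,T_1),\dots,(S_m,T_m)$ be all resistant pairs, indexed so that $T_1<\dots<T_m$, and put $T_0=[2,n]$. Let $S\subseteq[n]$ and nonempty $T\subseteq[2,n]$ satisfy $S\cap T=\{j\}$, $S\cup T=[j]$ where $j=\max T$, and $|S|\le k$, $|T|\le k$; let $\mathcal A=\mathcal L(S,k-1)$ and $\mathcal B=\mathcal L(T,k)$. If $T_{l-1}<T\le T_l$ for some $l\in[m]$, then $$|\mathcal A|+|\mathcal B|=|\mathcal L(S_l,k-1)|+|\mathcal L(T_l,k)|$$ holds if and only if $T$ is $T_l$-neutral.
   Context: $[a,b]=\{a,\dots,b\}$, $[j]=\{1,\dots,j\}$. Lexicographic order: for distinct finite sets $A,B$, $A<B$ iff $\min(A\triangle B)\in A$; $A\le B$ means $A<B$ or $A=B$. For $X\subseteq[n]$ and integer $a$, $\mathcal L(X,a)=\{A\in\binom{[2,n]}{a}: A\le X\cap[2,n]\}$. A pair $S\subseteq[n]$, $T\subseteq[2,n]$ ($T\ne\emptyset$, $j=\max T$) is a resistant pair if (1) $S\cap T=\{j\}$, $S\cup T=[j]$, $|S|\le k$, $|T|\le k$; and (2) for each $4\le i\le j$, $|[i]\cap S|<|[i]\setminus S|$; additionally the pair $S=\{1,4\}$, $T=\{2,3,4\}$ is declared resistant. For a set $T_l$, the $T_l$-neutral sets are defined recursively: $T_l$ is $T_l$-neutral, and if $T'$ is $T_l$-neutral then $T'\cup\{2|T'|\}$ is $T_l$-neutral (and no other sets are). (Here the set $S$ paired with $T$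 is determined by $S\cap T=\{\max T\}$, $S\cup T=[\max T]$.) *)

theory Defs
  imports Main
begin

definition lex_less :: "nat set \<Rightarrow> nat set \<Rightarrow> bool"
  where "lex_less A B \<longleftrightarrow> A \<noteq> B \<and> Min (sym_diff A B) \<in> A"
  (* Only applied to finite sets, where Min is meaningful.
     A proper superset precedes its subset, e.g. {2,3} < {2}. *)

definition lex_le :: "nat set \<Rightarrow> nat set \<Rightarrow> bool"
  where "lex_le A B \<longleftrightarrow> lex_less A B \<or> A = B"

definition lex_family :: "nat \<Rightarrow> nat set \<Rightarrow> nat \<Rightarrow> nat set set"
  where "lex_family n X a = {A. A \<subseteq> {2..n} \<and> card A = a \<and> lex_le A (X \<inter> {2..n})}"

definition partner_pair :: "nat \<Rightarrow> nat \<Rightarrow> nat set \<Rightarrow> nat set \<Rightarrow> bool"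
  where "partner_pair n k S T \<longleftrightarrow>
    S \<subseteq> {1..n} \<and> T \<subseteq> {2..n} \<and> T \<noteq> {} \<and>
    S \<inter> T = {Max T} \<and> S \<union> T = {1..Max T} \<and> card S \<le> k \<and> card T \<le> k"

definition resistant_pair :: "nat \<Rightarrow> nat \<Rightarrow> nat set \<Rightarrow> nat set \<Rightarrow> bool"
  where "resistant_pair n k S T \<longleftrightarrow>
    (partner_pair n k S T \<and> (\<forall>i\<in>{4..Max T}. card ({1..i} \<inter> S) < card ({1..i} - S)))
    \<or> (S = {1, 4} \<and> T = {2, 3, 4})"

inductive neutral :: "nat set \<Rightarrow> nat set \<Rightarrow> bool" for R :: "nat set"
  where
    base: "neutral R R"
  | step: "neutral R T \<Longrightarrow> neutral R (T \<union> {2 * card T})"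

end

theory Submission
  imports Defs HOL.Binomial_Plus
begin

text \<open>
  Write $w(T) = |\mathcal L(S,k-1)| + |\mathcal L(T,k)|$. Both summands are computed by reading the
  numbers $2, 3, \dots$ one at a time, and after shifting by the element $1 \in S$ the two
  computations are interchanged when $S$ and $T$ are. If $U = T \cap [i]$ is a nonempty proper initial
  segment of $T$, then $w(T)$ and $w(U)$ differ only in what is counted after $i$: from $i+1$ on, $U$
  contributes one binomial coefficient $\binom{n-i}{k-|U|}$. The symmetric two-sided count for $T$ is,
  by Pascal's rule, strictly smaller as soon as $2|U| \le i$, and it is equal to that coefficient if
  the only element of $T$ after $U$ is $2|U|$.

  The least resistant set $T_l \ge T$ is the longest resistant initial segment of $T$. Let $U$ be the
  longest $T_l$-neutral initial segment of $T$, and suppose that $T$ has a next element $d$. Then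
  $d < 2|U|$ would give a longer resistant initial segment and $d = 2|U|$ a longer neutral one, so
  $d > 2|U|$ and $w(T) < w(U) = w(T_l)$.
\<close>

subsection \<open>The lexicographic order\<close>

text \<open>The witness \<open>d\<close> is the minimum of the symmetric difference. Trading
  \<open>Min\<close> for a first point of difference lets later arguments work elementwise.\<close>

lemma lex_less_iff:
  assumes "finite A" "finite B"
  shows "lex_less A B \<longleftrightarrow> (\<exists>d. d \<in> A \<and> d \<notin> B \<and> (\<forall>x<d. x \<in> A \<longleftrightarrow> x \<in> B))"
proof
  assume "lex_less A B"
  then have ne: "sym_diff A B \<noteq> {}" and m: "Min (sym_diff A B) \<in> A"
    by (auto simp: lex_less_def)
  have fin: "finite (sym_diff A B)" using assms by simp
  define d where "d = Min (sym_diff A B)"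
  have "d \<in> sym_diff A B" using Min_in[OF fin ne] by (simp add: d_def)
  moreover have "x \<notin> sym_diff A B" if "x < d" for x
    using Min_le[OF fin, of x] that by (auto simp: d_def)
  ultimately show "\<exists>d. d \<in> A \<and> d \<notin> B \<and> (\<forall>x<d. x \<in> A \<longleftrightarrow> x \<in> B)"
    using m by (intro exI[of _ d]) (auto simp: d_def)
next
  assume "\<exists>d. d \<in> A \<and> d \<notin> B \<and> (\<forall>x<d. x \<in> A \<longleftrightarrow> x \<in> B)"
  then obtain d where d: "d \<in> A" "d \<notin> B" "(\<forall>x<d. x \<in> A \<longleftrightarrow> x \<in> B)" by blast
  have "Min (sym_diff A B) = d"
  proof (rule Min_eqI)
    fix y assume "y \<in> sym_diff A B"
    then show "d \<le> y" using d(3) by (metis Diff_iff UnE not_le)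
  qed (use assms d in auto)
  then show "lex_less A B" using d by (auto simp: lex_less_def)
qed

lemma lex_less_irrefl: "\<not> lex_less A A"
  by (simp add: lex_less_def)

text \<open>The first difference of \<open>A\<close> and \<open>C\<close> is the smaller of
  \<open>d\<close> and \<open>e\<close>; these are distinct because \<open>e\<close> lies in
  \<open>B\<close> and \<open>d\<close> does not.\<close>

lemma lex_less_trans:
  assumes fin: "finite A" "finite B" "finite C" and "lex_less A B" "lex_less B C"
  shows "lex_less A C"
proof -
  obtain d where d: "d \<in> A" "d \<notin> B" "\<forall>x<d. x \<in> A \<longleftrightarrow> x \<in> B"
    using \<open>lex_less A B\<close> lex_less_iff[OF fin(1,2)] by blast
  obtain e where e: "e \<in> B" "e \<notin> C" "\<forall>x<e. x \<in> B \<longleftrightarrow> x \<in> C"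
    using \<open>lex_less B C\<close> lex_less_iff[OF fin(2,3)] by blast
  have "\<exists>f. f \<in> A \<and> f \<notin> C \<and> (\<forall>x<f. x \<in> A \<longleftrightarrow> x \<in> C)"
  proof (cases "d < e")
    case True
    then show ?thesis using d e by (intro exI[of _ d]) simp
  next
    case False
    then have "e < d" using d e by (metis linorder_neqE_nat)
    then show ?thesis using d e by (intro exI[of _ e]) simp
  qed
  then show ?thesis using lex_less_iff[OF fin(1,3)] by blast
qed

lemma lex_less_imp_not_lex_le:
  assumes "finite A" "finite B" "lex_less A B"
  shows "\<not> lex_le B A"
  using assms lex_less_trans[of A B A] lex_less_irrefl[of A] by (metis lex_le_def)

text \<open>The least deleted element is the first difference, and it lies in \<open>T\<close>. This
  makes every resistant initial segment of \<open>T\<close> a competitor for the least resistant set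
  at or after \<open>T\<close>.\<close>

lemma lex_le_prefix:
  fixes T :: "nat set"
  assumes "finite T"
  shows "lex_le T (T \<inter> {..d})"
proof (cases "T \<inter> {d<..} = {}")
  case True
  then have "T \<inter> {..d} = T" by (auto simp: not_le)
  then show ?thesis by (simp add: lex_le_def)
next
  case False
  let ?m = "Min (T \<inter> {d<..})"
  have m: "?m \<in> T \<inter> {d<..}" using False assms by (intro Min_in) auto
  have "x \<le> d" if "x < ?m" "x \<in> T" for x
  proof (rule ccontr)
    assume "\<not> x \<le> d"
    then have "?m \<le> x" using that(2) assms by (intro Min_le) auto
    then show False using that(1) by simp
  qed
  then have "\<exists>e. e \<in> T \<and> e \<notin> T \<inter> {..d} \<and> (\<forall>x<e. x \<in> T \<longleftrightarrow> x \<in> T \<inter> {..d})"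
    using m by (intro exI[of _ ?m]) auto
  then have "lex_less T (T \<inter> {..d})" using assms by (subst lex_less_iff) simp_all
  then show ?thesis by (simp add: lex_le_def)
qed

lemma lex_le_insert_both:
  assumes "finite A" "finite B" "p \<notin> A" "p \<notin> B"
  shows "lex_le (insert p A) (insert p B) \<longleftrightarrow> lex_le A B"
proof -
  have *: "sym_diff (insert p A) (insert p B) = sym_diff A B" using assms by auto
  have "insert p A = insert p B \<longleftrightarrow> A = B" using assms by auto
  moreover have "Min (sym_diff A B) \<noteq> p" if "A \<noteq> B"
    using Min_in[of "sym_diff A B"] that assms by auto
  ultimately show ?thesis unfolding lex_le_def lex_less_def * by auto
qed

subsection \<open>Counting lexicographic initial segments\<close>

text \<open>The ground set starts at a variable \<open>p\<close> so that the count obeys a recursion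
  in \<open>p\<close>; \<open>p = 2\<close> recovers \<open>lex_family\<close>.\<close>

definition lex_count :: "nat \<Rightarrow> nat \<Rightarrow> nat \<Rightarrow> nat set \<Rightarrow> nat"
  where "lex_count n p a X = card {A. A \<subseteq> {p..n} \<and> card A = a \<and> lex_le A (X \<inter> {p..n})}"

lemma card_lex_family: "card (lex_family n X a) = lex_count n 2 a X"
  by (simp add: lex_family_def lex_count_def)

lemma lex_le_empty:
  assumes "finite A"
  shows "lex_le A {}"
  using assms Min_in[of A] by (cases "A = {}") (simp_all add: lex_le_def lex_less_def)

lemma lex_le_insert_left:
  assumes "A \<subseteq> {Suc p..n}" "B \<subseteq> {Suc p..n}"
  shows "lex_le (insert p A) B"
proof -
  have "finite A" "finite B" using assms finite_subset by blast+
  moreover have "p \<notin> B" "\<forall>x<p. x \<in> insert p A \<longleftrightarrow> x \<in> B" using assms by fastforce+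
  ultimately have "lex_less (insert p A) B" by (subst lex_less_iff) auto
  then show ?thesis by (simp add: lex_le_def)
qed

lemma not_lex_le_insert_right:
  assumes "A \<subseteq> {Suc p..n}" "B \<subseteq> {Suc p..n}"
  shows "\<not> lex_le A (insert p B)"
proof
  assume "lex_le A (insert p B)"
  moreover have "A \<noteq> insert p B" using assms by auto
  moreover have fin: "finite A" "finite (insert p B)" using assms finite_subset by blast+
  ultimately have "lex_less A (insert p B)" by (auto simp: lex_le_def)
  moreover have "lex_less (insert p B) A"
    using lex_le_insert_left[OF assms(2,1)] \<open>A \<noteq> insert p B\<close> by (auto simp: lex_le_def)
  ultimately show False using lex_less_trans[OF fin(1,2,1)] lex_less_irrefl by blast
qed

lemma lex_count_empty:
  assumes "X \<inter> {p..n} = {}"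
  shows "lex_count n p a X = (Suc n - p) choose a"
proof -
  have "{A. A \<subseteq> {p..n} \<and> card A = a \<and> lex_le A (X \<inter> {p..n})} = {A. A \<subseteq> {p..n} \<and> card A = a}"
    unfolding assms using lex_le_empty finite_subset[OF _ finite_atLeastAtMost] by blast
  then show ?thesis by (simp add: lex_count_def n_subsets)
qed

text \<open>A set within \<open>{p..n}\<close> that omits \<open>p\<close> comes after every set
  containing it. So all counted sets contain \<open>p\<close>, and deleting \<open>p\<close> is a
  bijection that respects the order.\<close>

lemma lex_count_in:
  assumes "p \<in> X" "p \<le> n"
  shows "lex_count n p (Suc a) X = lex_count n (Suc p) a X"
proof -
  have P: "{p..n} = insert p {Suc p..n}" using assms(2) by auto
  have P_notin: "p \<notin> A" if "A \<subseteq> {Suc p..n}" for A using that by auto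
  have X: "X \<inter> {p..n} = insert p (X \<inter> {Suc p..n})" using assms by (auto simp: P)
  have finX: "finite (X \<inter> {Suc p..n})" "p \<notin> X \<inter> {Suc p..n}" by auto
  let ?L = "{A. A \<subseteq> {Suc p..n} \<and> card A = a \<and> lex_le A (X \<inter> {Suc p..n})}"
  have "{A. A \<subseteq> {p..n} \<and> card A = Suc a \<and> lex_le A (X \<inter> {p..n})} = insert p ` ?L" (is "?M = _")
  proof
    show "?M \<subseteq> insert p ` ?L"
    proof
      fix A assume A: "A \<in> ?M"
      then have "finite A" by (auto intro: finite_subset)
      have "p \<in> A"
      proof (rule ccontr)
        assume "p \<notin> A"
        then have "A \<subseteq> {Suc p..n}" using A assms by (auto simp: P)
        then show False using A not_lex_le_insert_right[of A p n "X \<inter> {Suc p..n}"] X by auto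
      qed
      then have "A = insert p (A - {p})" by auto
      moreover have "A - {p} \<in> ?L"
      proof -
        have "lex_le (insert p (A - {p})) (insert p (X \<inter> {Suc p..n}))"
          using A X \<open>p \<in> A\<close> by (simp add: insert_absorb)
        then have "lex_le (A - {p}) (X \<inter> {Suc p..n})"
          by (subst (asm) lex_le_insert_both) (use finX \<open>finite A\<close> in auto)
        moreover have "A - {p} \<subseteq> {Suc p..n}" using A P by auto
        ultimately show ?thesis using A \<open>p \<in> A\<close> \<open>finite A\<close> by simp
      qed
      ultimately show "A \<in> insert p ` ?L" by blast
    qed
    show "insert p ` ?L \<subseteq> ?M"
    proof
      fix B assume "B \<in> insert p ` ?L"
      then obtain A where A: "A \<in> ?L" "B = insert p A" by blast
      then have "finite A" "p \<notin> A" by (auto intro: finite_subset)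
      then have "lex_le (insert p A) (X \<inter> {p..n})"
        using A lex_le_insert_both[of A "X \<inter> {Suc p..n}" p] finX X by simp
      then show "B \<in> ?M" using A \<open>finite A\<close> \<open>p \<notin> A\<close> P by auto
    qed
  qed
  moreover have "inj_on (insert p) ?L"
    by (rule inj_onI) (metis (lifting) P_notin insert_ident mem_Collect_eq)
  ultimately show ?thesis by (simp add: lex_count_def card_image)
qed

text \<open>Sets containing \<open>p\<close> precede \<open>X\<close> whatever their other elements
  are, which yields the binomial coefficient; the remaining sets compare with \<open>X\<close>
  beyond \<open>p\<close> only.\<close>

lemma lex_count_notin:
  assumes "p \<notin> X" "p \<le> n"
  shows "lex_count n p (Suc a) X = ((n - p) choose a) + lex_count n (Suc p) (Suc a) X"
proof -
  have P: "{p..n} = insert p {Suc p..n}" using assms(2) by auto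
  have P_notin: "p \<notin> A" if "A \<subseteq> {Suc p..n}" for A using that by auto
  have X: "X \<inter> {p..n} = X \<inter> {Suc p..n}" using assms by (auto simp: P)
  let ?L = "{A. A \<subseteq> {Suc p..n} \<and> card A = Suc a \<and> lex_le A (X \<inter> {Suc p..n})}"
  let ?K = "{A. A \<subseteq> {Suc p..n} \<and> card A = a}"
  have "{A. A \<subseteq> {p..n} \<and> card A = Suc a \<and> lex_le A (X \<inter> {p..n})} = insert p ` ?K \<union> ?L" (is "?M = _")
  proof
    show "?M \<subseteq> insert p ` ?K \<union> ?L"
    proof
      fix A assume A: "A \<in> ?M"
      then have "finite A" by (auto intro: finite_subset)
      show "A \<in> insert p ` ?K \<union> ?L"
      proof (cases "p \<in> A")
        case True
        then have "A = insert p (A - {p})" by auto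
        moreover have "A - {p} \<in> ?K"
          using A True \<open>finite A\<close> P by auto
        ultimately show ?thesis by blast
      next
        case False
        then have "A \<subseteq> {Suc p..n}" using A assms by (auto simp: P)
        then show ?thesis using A X by auto
      qed
    qed
    show "insert p ` ?K \<union> ?L \<subseteq> ?M"
    proof
      fix B assume "B \<in> insert p ` ?K \<union> ?L"
      then consider A where "A \<in> ?K" "B = insert p A" | "B \<in> ?L" by blast
      then show "B \<in> ?M"
      proof cases
        case (1 A)
        then have "finite A" "p \<notin> A" by (auto intro: finite_subset)
        moreover have "lex_le (insert p A) (X \<inter> {p..n})"
          using 1 lex_le_insert_left[of A p n "X \<inter> {Suc p..n}"] X by simp
        ultimately show ?thesis using 1 P by auto
      next
        case 2
        then show ?thesis using X P by auto
      qed
    qed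
  qed
  moreover have "inj_on (insert p) ?K"
    by (rule inj_onI) (metis (lifting) P_notin insert_ident mem_Collect_eq)
  moreover have "insert p ` ?K \<inter> ?L = {}" by auto
  moreover have "finite ?K" "finite ?L" by auto
  ultimately show ?thesis
    by (simp add: lex_count_def card_image card_Un_disjoint n_subsets)
qed

lemma lex_count_notin_0:
  assumes "p \<notin> X" "p \<le> n"
  shows "lex_count n p 0 X = lex_count n (Suc p) 0 X"
proof -
  have P: "{p..n} = insert p {Suc p..n}" using assms by auto
  have X: "X \<inter> {p..n} = X \<inter> {Suc p..n}" using assms by (auto simp: P)
  have "A \<subseteq> {q..n} \<and> card A = 0 \<longleftrightarrow> A = {}" for A and q :: nat
    by (auto dest: finite_subset)
  then show ?thesis unfolding lex_count_def X by (simp add: conj_assoc[symmetric])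
qed

text \<open>While \<open>X\<close> and \<open>Y\<close> agree, each number read contributes the same
  amount to both counts, so their difference is carried from \<open>p\<close> to \<open>q\<close>.
  The additive form avoids truncated subtraction, and the bound by \<open>a\<close> keeps the
  remaining size exact.\<close>

lemma lex_count_common_prefix:
  assumes "p \<le> q" "q \<le> Suc n" "\<And>x. p \<le> x \<Longrightarrow> x < q \<Longrightarrow> x \<in> X \<longleftrightarrow> x \<in> Y" "card (X \<inter> {p..<q}) \<le> a"
  shows "lex_count n p a X + lex_count n q (a - card (X \<inter> {p..<q})) Y
       = lex_count n p a Y + lex_count n q (a - card (X \<inter> {p..<q})) X"
  using assms
proof (induction q rule: dec_induct)
  case base
  then show ?case by simp
next
  case (step q)
  have q: "{p..<Suc q} = insert q {p..<q}" using step.hyps by auto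
  have agree: "q \<in> X \<longleftrightarrow> q \<in> Y" using step by simp
  let ?c = "card (X \<inter> {p..<q})"
  have "?c \<le> card (X \<inter> {p..<Suc q})" by (intro card_mono) auto
  then have IH: "lex_count n p a X + lex_count n q (a - ?c) Y = lex_count n p a Y + lex_count n q (a - ?c) X"
    using step.prems by (intro step.IH) auto
  show ?case
  proof (cases "q \<in> X")
    case True
    then have c: "card (X \<inter> {p..<Suc q}) = Suc ?c" by (simp add: q)
    then have "a - ?c = Suc (a - Suc ?c)" using step.prems by simp
    then show ?thesis
      using IH agree True c lex_count_in[of q X n] lex_count_in[of q Y n] \<open>Suc q \<le> Suc n\<close> by simp
  next
    case False
    then have c: "card (X \<inter> {p..<Suc q}) = ?c" by (simp add: q)
    then show ?thesis
      using IH agree False c lex_count_notin[of q X n] lex_count_notin[of q Y n]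
        lex_count_notin_0[of q X n] lex_count_notin_0[of q Y n] \<open>Suc q \<le> Suc n\<close>
      by (cases "a - ?c") auto
  qed
qed

text \<open>Reading an element of \<open>X\<close> lowers the size but adds nothing to the
  count.\<close>

lemma lex_count_run:
  assumes "p \<le> q" "q \<le> Suc n" "\<And>x. p \<le> x \<Longrightarrow> x < q \<Longrightarrow> x \<in> X" "q - p \<le> a"
  shows "lex_count n p a X = lex_count n q (a - (q - p)) X"
  using assms
proof (induction q rule: dec_induct)
  case base
  show ?case by simp
next
  case (step q)
  have IH: "lex_count n p a X = lex_count n q (a - (q - p)) X"
    using step.prems step.hyps by (intro step.IH) simp_all
  have e: "a - (q - p) = Suc (a - (Suc q - p))" using step.prems(3) step.hyps by linarith
  have "q \<in> X" using step.prems(2) step.hyps by simp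
  then show ?case
    unfolding IH e using lex_count_in[of q X n] step.prems(1) by blast
qed

section \<open>Binomial bounds for two complementary sets\<close>

lemma binomial_less_binomial:
  assumes "a < b" "a + b < N"
  shows "N choose a < N choose b"
proof (cases "2 * b \<le> N")
  case True
  then show ?thesis using assms binomial_strict_mono by blast
next
  case False
  \<comment> \<open>Beyond the middle, \<open>b\<close> is reflected to \<open>N - b\<close>, which
    still exceeds \<open>a\<close> because \<open>a + b < N\<close>.\<close>
  then have "N choose a < N choose (N - b)"
    using assms by (intro binomial_strict_mono) auto
  then show ?thesis using assms binomial_symmetric[of b N] by simp
qed

text \<open>Downward induction on \<open>p\<close> from the shared last element \<open>j\<close>. At
  each earlier number one set gains a binomial coefficient while the other loses one unit of size,
  and Pascal's rule absorbs the gain. The last hypothesis leaves room for the binomial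
  comparisons.\<close>

lemma lex_count_pair_less:
  assumes "p \<le> j" "j \<le> n" "j \<in> S" "j \<in> T"
    and "\<And>x. p \<le> x \<Longrightarrow> x < j \<Longrightarrow> x \<in> S \<longleftrightarrow> x \<notin> T"
    and "\<And>x. j < x \<Longrightarrow> x \<le> n \<Longrightarrow> x \<notin> S \<and> x \<notin> T"
    and "card (S \<inter> {p..n}) \<le> Suc a" "card (T \<inter> {p..n}) \<le> Suc b" "p + a + b + 2 \<le> n"
  shows "lex_count n p (Suc a) S + lex_count n p (Suc b) T < (Suc n - p) choose Suc (max a b)"
  using assms
proof (induction p arbitrary: S T a b rule: inc_induct)
  case base
  have e: "S \<inter> {Suc j..n} = {}" "T \<inter> {Suc j..n} = {}"
    using base.prems(5) by (auto simp: Suc_le_eq)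
  have l: "lex_count n j (Suc a) S = (n - j) choose a" "lex_count n j (Suc b) T = (n - j) choose b"
    using e base.prems lex_count_in lex_count_empty by simp_all
  \<comment> \<open>Only the smaller coefficient has to be raised: the larger one is already a term
    of Pascal's rule for \<open>Suc (max a b)\<close>.\<close>
  have "n - j choose min a b < n - j choose Suc (max a b)"
    using base.prems(8) by (intro binomial_less_binomial) auto
  moreover have "(n - j choose a) + (n - j choose b)
      = (n - j choose min a b) + (n - j choose max a b)"
    by (auto simp: min_def max_def)
  moreover have "Suc n - j = Suc (n - j)" using base.prems by simp
  ultimately show ?case using l by simp
next
  case (step p)
  have pn: "p \<le> n" using step.hyps step.prems by simp
  \<comment> \<open>Generalised over both sets and both sizes, so that the case
    \<open>p \<in> T\<close> follows by exchanging roles.\<close>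
  have main: "lex_count n p (Suc a) S + lex_count n p (Suc b) T < (Suc n - p) choose Suc (max a b)"
    if "p \<in> S" and prems: "j \<in> S" "j \<in> T"
      "\<And>x. p \<le> x \<Longrightarrow> x < j \<Longrightarrow> x \<in> S \<longleftrightarrow> x \<notin> T"
      "\<And>x. j < x \<Longrightarrow> x \<le> n \<Longrightarrow> x \<notin> S \<and> x \<notin> T"
      "card (S \<inter> {p..n}) \<le> Suc a" "card (T \<inter> {p..n}) \<le> Suc b" "p + a + b + 2 \<le> n"
    for S T a b
  proof -
    have "p \<notin> T" using that step.hyps by simp
    have P: "{p..n} = insert p {Suc p..n}" using pn by auto
    have SP: "S \<inter> {p..n} = insert p (S \<inter> {Suc p..n})" using P \<open>p \<in> S\<close> by auto
    have TP: "T \<inter> {p..n} = T \<inter> {Suc p..n}" using P \<open>p \<notin> T\<close> by auto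
    have cS: "card (S \<inter> {p..n}) = Suc (card (S \<inter> {Suc p..n}))" unfolding SP by simp
    \<comment> \<open>The shared element \<open>j\<close> is still to come, so \<open>S\<close> has
      at least two elements from \<open>p\<close> on and \<open>a\<close> is positive.\<close>
    have "j \<in> S \<inter> {Suc p..n}" using prems(1) step.hyps \<open>j \<le> n\<close> by simp
    then have "card (S \<inter> {Suc p..n}) \<noteq> 0" by (metis card_0_eq empty_iff finite_Int finite_atLeastAtMost)
    then obtain a' where a': "a = Suc a'" using prems(5) cS by (cases a) auto
    have IH: "lex_count n (Suc p) (Suc a') S + lex_count n (Suc p) (Suc b) T
        < (Suc n - Suc p) choose Suc (max a' b)"
      using prems cS TP a' \<open>j \<le> n\<close> by (intro step.IH) simp_all
    have "lex_count n p (Suc a) S + lex_count n p (Suc b) T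
        = (n - p choose b) + (lex_count n (Suc p) (Suc a') S + lex_count n (Suc p) (Suc b) T)"
      using lex_count_in[OF \<open>p \<in> S\<close> pn] lex_count_notin[OF \<open>p \<notin> T\<close> pn] a' by simp
    also have "\<dots> < (n - p choose b) + (n - p choose Suc (max a' b))" using IH by simp
    \<comment> \<open>If \<open>a \<le> b\<close> then \<open>a' < b\<close> and both sides
      coincide. Otherwise the coefficient at \<open>b\<close> must be raised to the one at
      \<open>Suc a\<close>.\<close>
    also have "\<dots> \<le> (n - p choose max a b) + (n - p choose Suc (max a b))"
    proof (cases "a \<le> b")
      case True
      then show ?thesis using a' by (simp add: max_def)
    next
      case False
      then have "n - p choose b < n - p choose Suc a"
        using prems(7) by (intro binomial_less_binomial) auto
      moreover have "max a b = a" "max a' b = a'" using a' False by auto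
      ultimately show ?thesis using a' by simp
    qed
    also have "\<dots> = Suc n - p choose Suc (max a b)" using pn by (simp add: Suc_diff_le)
    finally show ?thesis .
  qed
  show ?case
  proof (cases "p \<in> S")
    case True
    then show ?thesis using step.prems by (intro main)
  next
    case False
    then have "p \<in> T" using step.prems step.hyps by simp
    then have "lex_count n p (Suc b) T + lex_count n p (Suc a) S < (Suc n - p) choose Suc (max b a)"
      using step.prems by (intro main) auto
    then show ?thesis by (simp add: max.commute add.commute)
  qed
qed

subsection \<open>Partner pairs and their initial segments\<close>

text \<open>The conditions on intersection and union leave no choice for \<open>S\<close>, so a pair
  can be handled through \<open>T\<close> alone.\<close>

definition partner :: "nat set \<Rightarrow> nat set"
  where "partner T = insert (Max T) ({1..Max T} - T)"

text \<open>This is w(T) of the overview. Size \<open>k - 1\<close> on the partner side makes up for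
  the element 1, which lies in the partner but outside the range that is read.\<close>

definition total_count :: "nat \<Rightarrow> nat \<Rightarrow> nat set \<Rightarrow> nat"
  where "total_count n k T = lex_count n 2 (k - 1) (partner T) + lex_count n 2 k T"

lemma card_partner:
  assumes "finite T" "T \<noteq> {}" "T \<subseteq> {2..n}"
  shows "card (partner T) + card T = Suc (Max T)"
proof -
  have T: "T \<subseteq> {1..Max T}" using assms by (auto simp: subset_iff intro: Max_ge)
  have "Max T \<in> T" using assms by simp
  then have "card (partner T) = Suc (card ({1..Max T} - T))" by (simp add: partner_def)
  also have "card ({1..Max T} - T) = Max T - card T" using T assms by (simp add: card_Diff_subset)
  finally show ?thesis using card_mono[OF _ T] by simp
qed

text \<open>The sizes of \<open>T\<close> and its partner add up to \<open>Suc (Max T)\<close>,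
  which turns the bound on \<open>S\<close> into one on \<open>Max T\<close>.\<close>

lemma partner_pair_iff:
  "partner_pair n k S T \<longleftrightarrow>
    S = partner T \<and> T \<noteq> {} \<and> T \<subseteq> {2..n} \<and> Max T < k + card T \<and> card T \<le> k"
proof (cases "T \<noteq> {} \<and> T \<subseteq> {2..n}")
  case True
  then have T: "finite T" "T \<noteq> {}" "T \<subseteq> {2..n}" using finite_subset by blast+
  then have m: "Max T \<in> T" and le: "\<And>x. x \<in> T \<Longrightarrow> x \<le> Max T" by auto
  have ge: "2 \<le> x" "x \<le> n" if "x \<in> T" for x using that T(3) by auto
  have "S \<inter> T = {Max T} \<and> S \<union> T = {1..Max T} \<longleftrightarrow> S = partner T"
  proof
    assume "S \<inter> T = {Max T} \<and> S \<union> T = {1..Max T}"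
    then show "S = partner T" unfolding partner_def by blast
  next
    have "T \<subseteq> {1..Max T}" using le ge(1) by fastforce
    moreover assume "S = partner T"
    ultimately show "S \<inter> T = {Max T} \<and> S \<union> T = {1..Max T}"
      using m unfolding partner_def by blast
  qed
  moreover have "partner T \<subseteq> {1..n}"
  proof -
    have "Max T \<le> n" "2 \<le> Max T" using ge m by blast+
    then show ?thesis by (auto simp: partner_def)
  qed
  moreover have "card (partner T) \<le> k \<longleftrightarrow> Max T < k + card T"
    using card_partner[OF T] by linarith
  ultimately show ?thesis using True unfolding partner_pair_def by metis
next
  case False
  then show ?thesis by (auto simp: partner_pair_def)
qed

section \<open>Comparing a pair with its initial segments\<close>

lemma card_prefix_partner:
  assumes "T \<subseteq> {2..n}" "T \<noteq> {}" "i < Max T"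
  shows "card (partner T \<inter> {1..i}) + card (T \<inter> {..i}) = i"
proof -
  have "partner T \<inter> {1..i} = {1..i} - T \<inter> {..i}" using assms(3) by (auto simp: partner_def)
  moreover have "T \<inter> {..i} \<subseteq> {1..i}" using assms(1) by auto
  ultimately show ?thesis using card_mono[of "{1..i}" "T \<inter> {..i}"]
    by (simp add: card_Diff_subset finite_subset)
qed

lemma card_split_at:
  fixes X :: "nat set"
  assumes "X \<subseteq> {1..n}"
  shows "card (X \<inter> {1..i}) + card (X \<inter> {Suc i..n}) = card X"
proof -
  have "card (X \<inter> {1..i} \<union> X \<inter> {Suc i..n}) = card (X \<inter> {1..i}) + card (X \<inter> {Suc i..n})"
    by (intro card_Un_disjoint) auto
  moreover have "X \<inter> {1..i} \<union> X \<inter> {Suc i..n} = X" using assms by (auto simp: not_less_eq_eq subset_iff)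
  ultimately show ?thesis by simp
qed

lemma Max_prefix:
  fixes T :: "nat set"
  assumes "d \<in> T"
  shows "Max (T \<inter> {..d}) = d"
  using assms by (intro Max_eqI) auto

text \<open>Up to \<open>i\<close> both pairs accumulate the same total; beyond \<open>i\<close> the
  pair of \<open>U\<close> has one binomial coefficient left and the pair of \<open>T\<close> has
  its two remaining counts. The partner has \<open>i - card U\<close> elements up to
  \<open>i\<close>, the element 1 included, hence its remaining size.\<close>

lemma total_count_prefix:
  assumes T: "partner_pair n k (partner T) T" and i: "i < Max T"
    and U: "U = T \<inter> {..i}" "U \<noteq> {}"
  shows "total_count n k T + (n - i choose (k - card U))
    = total_count n k U + lex_count n (Suc i) (k - (i - card U)) (partner T)
      + lex_count n (Suc i) (k - card U) T"
proof -
  let ?S = "partner T"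
  have T': "T \<noteq> {}" "T \<subseteq> {2..n}" "card T \<le> k" "finite T"
    using T finite_subset by (auto simp: partner_pair_iff)
  have S: "?S \<subseteq> {1..n}" "card ?S \<le> k" using T by (auto simp: partner_pair_def)
  have "Max T \<in> T" using T' by simp
  then have j: "Max T \<le> n" using T' by auto
  have finU: "finite U" using U by simp
  \<comment> \<open>At \<open>r\<close> the partners part ways: \<open>partner U\<close> contains
    \<open>r\<close> and ends there, while \<open>?S\<close> omits it.\<close>
  define r where "r = Max U"
  have "r \<in> U" unfolding r_def using Max_in[OF finU U(2)] .
  then have r: "r \<in> T" "r \<le> i" "2 \<le> r" "r < Max T" using U T' i by auto
  have le: "x \<le> r" if "x \<in> T" "x \<le> i" for x using that U finU by (simp add: r_def)
  have "{2..<Suc i} \<inter> U = U" using U T' by auto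
  then have cU: "U \<inter> {2..<Suc i} = U" by blast
  have TU: "T \<inter> {2..<Suc i} = U" using U T' by auto
  have cT: "card U \<le> k" using U T' card_mono[of T U] by simp

  have "U \<inter> {Suc i..n} = {}" using U by auto
  then have "lex_count n (Suc i) (k - card U) U = (n - i choose (k - card U))"
    by (simp add: lex_count_empty)
  moreover have "lex_count n 2 k T + lex_count n (Suc i) (k - card U) U
      = lex_count n 2 k U + lex_count n (Suc i) (k - card U) T"
    using lex_count_common_prefix[of 2 "Suc i" n T U k] U T' TU cT i j r by auto
  ultimately have eqT: "lex_count n 2 k T + (n - i choose (k - card U))
      = lex_count n 2 k U + lex_count n (Suc i) (k - card U) T" by simp

  let ?c = "card (?S \<inter> {2..<r})"
  have cS: "card (?S \<inter> {1..i}) + card U = i" using card_prefix_partner[OF T'(2,1) i] U by simp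
  \<comment> \<open>The element 1 is split off because reading starts at 2, \<open>r\<close> is
    missing since it belongs to \<open>T\<close>, and the gap from \<open>Suc r\<close> to
    \<open>i\<close> lies wholly in \<open>?S\<close>.\<close>
  have "?S \<inter> {1..i} = insert 1 (?S \<inter> {2..<r} \<union> {Suc r..i})" (is "_ = ?R")
  proof (intro set_eqI iffI)
    fix x assume "x \<in> ?S \<inter> {1..i}"
    then have "1 \<le> x" "x \<le> i" "x \<notin> T" "x \<in> ?S" using i by (auto simp: partner_def)
    then show "x \<in> ?R" using r by (cases "x = 1"; cases "x = r") auto
  next
    fix x assume "x \<in> ?R"
    then consider "x = 1" | "x \<in> ?S" "2 \<le> x" "x < r" | "r < x" "x \<le> i" by auto
    then show "x \<in> ?S \<inter> {1..i}"
    proof cases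
      case 1
      then show ?thesis using T' r i by (auto simp: partner_def)
    next
      case 2
      then show ?thesis using r by auto
    next
      case 3
      then have "x \<notin> T" using le by fastforce
      then show ?thesis using 3 i by (auto simp: partner_def)
    qed
  qed
  moreover have "card (?S \<inter> {2..<r} \<union> {Suc r..i}) = ?c + (i - r)"
    by (subst card_Un_disjoint) auto
  moreover have "1 \<notin> ?S \<inter> {2..<r} \<union> {Suc r..i}" using r by auto
  ultimately have c: "card (?S \<inter> {1..i}) = Suc (?c + (i - r))"
    by (simp only: card_insert_disjoint finite_Un finite_Int finite_atLeastLessThan
        finite_atLeastAtMost simp_thms)
  \<comment> \<open>\<open>?S\<close> still has an element beyond \<open>i\<close>, so fewer than
    \<open>k\<close> of its elements are at most \<open>i\<close>. Hence the size left at
    \<open>r\<close> is positive, and the gap does not exhaust it.\<close>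
  have "Max T \<in> ?S \<inter> {Suc i..n}" using i j by (simp add: partner_def)
  then have "card (?S \<inter> {Suc i..n}) > 0" by (metis card_gt_0_iff empty_iff finite_Int finite_atLeastAtMost)
  then have less: "card (?S \<inter> {1..i}) < k" using card_split_at[OF S(1), of i] S(2) by linarith
  obtain b where b: "k - 1 - ?c = Suc b" using less c by (cases "k - 1 - ?c") auto
  have "\<And>x. 2 \<le> x \<Longrightarrow> x < r \<Longrightarrow> x \<in> ?S \<longleftrightarrow> x \<in> partner U"
  proof -
    have "x \<in> U \<longleftrightarrow> x \<in> T" if "x < r" for x using that r(2) U(1) by auto
    then show "x \<in> ?S \<longleftrightarrow> x \<in> partner U" if "2 \<le> x" "x < r" for x
      using that r(4) unfolding partner_def r_def[symmetric] by auto
  qed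
  then have "lex_count n 2 (k - 1) ?S + lex_count n r (k - 1 - ?c) (partner U)
       = lex_count n 2 (k - 1) (partner U) + lex_count n r (k - 1 - ?c) ?S"
    using r j less c by (intro lex_count_common_prefix) auto
  moreover have "lex_count n r (Suc b) (partner U) = (n - r choose b)"
  proof -
    have "r \<in> partner U" "partner U \<inter> {Suc r..n} = {}" by (auto simp: partner_def r_def)
    then show ?thesis using r j by (simp add: lex_count_in lex_count_empty)
  qed
  \<comment> \<open>By omitting \<open>r\<close>, \<open>?S\<close> gains the very coefficient that
    \<open>partner U\<close> receives for ending there. The gap after \<open>r\<close> then costs
    only size.\<close>
  moreover have "r \<notin> ?S" using r by (auto simp: partner_def)
  then have "lex_count n r (Suc b) ?S = (n - r choose b) + lex_count n (Suc r) (Suc b) ?S"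
    using r j by (simp add: lex_count_notin)
  moreover have run: "lex_count n (Suc r) (Suc b) ?S = lex_count n (Suc i) (Suc b - (Suc i - Suc r)) ?S"
  proof (rule lex_count_run)
    show "x \<in> ?S" if "Suc r \<le> x" "x < Suc i" for x
      using that le[of x] i by (auto simp: partner_def)
  qed (use r i j b c less in auto)
  moreover have "Suc b - (Suc i - Suc r) = k - (i - card U)" using b c less cS r by linarith
  note run[unfolded this]
  ultimately have eqS: "lex_count n 2 (k - 1) ?S
      = lex_count n 2 (k - 1) (partner U) + lex_count n (Suc i) (k - (i - card U)) ?S"
    unfolding b by linarith
  show ?thesis unfolding total_count_def using eqS eqT by linarith
qed

text \<open>Since \<open>2 * card U \<le> i\<close>, the partner has used at least as many elements
  as \<open>U\<close>, so the larger remaining size is \<open>k - card U\<close>. The bound on the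
  two remaining counts is then exactly the coefficient belonging to \<open>U\<close>.\<close>

lemma total_count_prefix_less:
  assumes n: "2 * k < n" and T: "partner_pair n k (partner T) T" and i: "i < Max T"
    and U: "U = T \<inter> {..i}" "U \<noteq> {}" and "2 * card U \<le> i"
  shows "total_count n k T < total_count n k U"
proof -
  let ?S = "partner T"
  have T': "T \<noteq> {}" "T \<subseteq> {2..n}" "card T \<le> k" "finite T"
    using T finite_subset by (auto simp: partner_pair_iff)
  have S: "?S \<subseteq> {1..n}" "card ?S \<le> k" using T by (auto simp: partner_pair_def)
  have jT: "Max T \<in> T" using T' by simp
  then have j: "Max T \<le> n" using T' by auto
  have cS: "card (?S \<inter> {1..i}) + card U = i" using card_prefix_partner[OF T'(2,1) i] U by simp
  have T1: "T \<subseteq> {1..n}" "T \<inter> {1..i} = U" using T' U by auto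
  have "Max T \<in> ?S \<inter> {Suc i..n}" "Max T \<in> T \<inter> {Suc i..n}" using i j jT by (simp_all add: partner_def)
  then have "card (?S \<inter> {Suc i..n}) > 0" "card (T \<inter> {Suc i..n}) > 0"
    by (metis card_gt_0_iff empty_iff finite_Int finite_atLeastAtMost)+
  moreover have cT: "card U + card (T \<inter> {Suc i..n}) = card T"
    using card_split_at[OF T1(1), of i] T1(2) by simp
  ultimately have less: "card (?S \<inter> {1..i}) < k" "card U < k"
    using card_split_at[OF S(1), of i] S(2) T' by linarith+
  define a b where ab: "a = k - (i - card U) - 1" "b = k - card U - 1"
  have ab': "Suc a = k - (i - card U)" "Suc b = k - card U" "a \<le> b"
    using ab less cS \<open>2 * card U \<le> i\<close> by linarith+
  have "lex_count n (Suc i) (Suc a) ?S + lex_count n (Suc i) (Suc b) T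
      < (Suc n - Suc i) choose Suc (max a b)"
  proof (rule lex_count_pair_less[where j = "Max T"])
    show "Max T \<in> ?S" by (simp add: partner_def)
    show "\<And>x. Suc i \<le> x \<Longrightarrow> x < Max T \<Longrightarrow> x \<in> ?S \<longleftrightarrow> x \<notin> T"
      by (auto simp: partner_def)
    show "\<And>x. Max T < x \<Longrightarrow> x \<le> n \<Longrightarrow> x \<notin> ?S \<and> x \<notin> T"
      using Max_ge[OF T'(4)] by (auto simp: partner_def dest: leD)
    show "card (?S \<inter> {Suc i..n}) \<le> Suc a" "card (T \<inter> {Suc i..n}) \<le> Suc b"
      using card_split_at[OF S(1), of i] cT S(2) T' ab' cS
      by linarith+
    \<comment> \<open>The left side equals \<open>2 * k + 1\<close>.\<close>
    show "Suc i + a + b + 2 \<le> n" using ab' n less cS by linarith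
  qed (use i j jT in auto)
  then have "lex_count n (Suc i) (k - (i - card U)) ?S + lex_count n (Suc i) (k - card U) T
      < (n - i choose (k - card U))"
    using ab' by (simp add: max_def)
  then show ?thesis using total_count_prefix[OF T i U] by linarith
qed

text \<open>With \<open>i = 2 * card U - 1\<close> the partner has \<open>card U - 1\<close>
  elements up to \<open>i\<close>. Reading the single further element leaves coefficients at
  \<open>k - card U\<close> and \<open>k - card U - 1\<close>, whose sum by Pascal's rule is the one
  belonging to \<open>U\<close>.\<close>

lemma total_count_neutral_step:
  assumes T: "partner_pair n k (partner T) T" "T = insert (2 * card U) U"
    and U: "U \<noteq> {}" "finite U" "Max U < 2 * card U"
  shows "total_count n k T = total_count n k U"
proof -
  let ?q = "2 * card U"
  have lt: "x < ?q" if "x \<in> U" for x using that U Max_ge[of U x] by linarith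
  then have qU: "?q \<notin> U" by blast
  have M: "Max T = ?q" unfolding T(2) using lt U by (intro Max_eqI) (auto intro: less_imp_le)
  have qpos: "card U > 0" using U by (simp add: card_gt_0_iff)
  define i where "i = ?q - 1"
  have i: "Suc i = ?q" using qpos by (simp add: i_def)
  have Ui: "U = T \<inter> {..i}" unfolding T(2) using lt i by fastforce
  have Tk: "T \<subseteq> {2..n}" "card T \<le> k" using T(1) by (auto simp: partner_pair_iff)
  have "card T = Suc (card U)" unfolding T(2) using qU U by simp
  then have q: "?q \<le> n" "card U < k" using T(2) Tk by auto
  have "lex_count n (Suc i) (k - (i - card U)) (partner T) = (n - ?q choose (k - card U))"
  proof -
    have "k - (i - card U) = Suc (k - card U)" using i q qpos by linarith
    moreover have "?q \<in> partner T" "partner T \<inter> {Suc ?q..n} = {}" using M by (auto simp: partner_def)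
    ultimately show ?thesis unfolding i using q by (simp add: lex_count_in lex_count_empty)
  qed
  moreover have "lex_count n (Suc i) (k - card U) T = (n - ?q choose (k - card U - 1))"
  proof -
    have "k - card U = Suc (k - card U - 1)" using q by linarith
    moreover have "?q \<in> T" "T \<inter> {Suc ?q..n} = {}" unfolding T(2) using lt by fastforce+
    ultimately show ?thesis unfolding i using q lex_count_in[of ?q T n "k - card U - 1"]
      by (simp add: lex_count_empty)
  qed
  moreover have "(n - i choose (k - card U))
      = (n - ?q choose (k - card U)) + (n - ?q choose (k - card U - 1))"
  proof -
    have "n - i = Suc (n - ?q)" "k - card U = Suc (k - card U - 1)" using i q by linarith+
    then show ?thesis by (metis add.commute binomial_Suc_Suc)
  qed
  ultimately show ?thesis
    using total_count_prefix[OF T(1) _ Ui U(1)] i M by simp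
qed

subsection \<open>Resistant and neutral sets\<close>

text \<open>Within \<open>{1..i}\<close> the complement of \<open>S\<close> is \<open>T\<close>
  without its maximum, and the two parts have \<open>i\<close> elements together. The exceptional
  pair is itself a partner pair under these bounds on \<open>k\<close> and \<open>n\<close>.\<close>

lemma resistant_pair_iff:
  assumes "3 \<le> k" "2 * k < n"
  shows "resistant_pair n k S T \<longleftrightarrow> partner_pair n k S T \<and>
    (T = {2, 3, 4} \<or> (\<forall>i\<in>{4..Max T}. i < 2 * card ((T - {Max T}) \<inter> {..i})))"
proof -
  have a: "(\<forall>i\<in>{4..Max T}. card ({1..i} \<inter> S) < card ({1..i} - S))
     \<longleftrightarrow> (\<forall>i\<in>{4..Max T}. i < 2 * card ((T - {Max T}) \<inter> {..i}))" if "partner_pair n k S T"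
  proof (rule ball_cong[OF refl])
    fix i assume i: "i \<in> {4..Max T}"
    have ST: "S = partner T" "T \<subseteq> {2..n}" using that by (auto simp: partner_pair_iff)
    have *: "{1..i} - S = (T - {Max T}) \<inter> {..i}" using i ST(2) by (auto simp: ST(1) partner_def)
    moreover have "card ({1..i} \<inter> S) + card ({1..i} - S) = i"
      using card_Int_Diff[of "{1..i}" S] by simp
    ultimately show "card ({1..i} \<inter> S) < card ({1..i} - S)
        \<longleftrightarrow> i < 2 * card ((T - {Max T}) \<inter> {..i})" unfolding * by linarith
  qed
  have p: "partner {2, 3, 4} = {1, 4}" by (auto simp: partner_def)
  have "partner_pair n k {1, 4} {2, 3, 4}" unfolding partner_pair_iff p using assms by simp
  then have b: "S = {1, 4} \<and> T = {2, 3, 4} \<longleftrightarrow> partner_pair n k S T \<and> T = {2, 3, 4}"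
    unfolding partner_pair_iff by (metis p)
  show ?thesis
  proof (cases "partner_pair n k S T")
    case True
    show ?thesis unfolding resistant_pair_def b a[OF True] by (simp only: True simp_thms disj_commute)
  next
    case False
    then show ?thesis unfolding resistant_pair_def b by (simp only: simp_thms)
  qed
qed

text \<open>Cutting at \<open>d\<close> loses at most \<open>Max T - d\<close> elements, so the
  bound on the maximum survives.\<close>

lemma partner_pair_prefix:
  assumes T: "partner_pair n k (partner T) T" and "d \<in> T"
  shows "partner_pair n k (partner (T \<inter> {..d})) (T \<inter> {..d})"
proof -
  have T': "T \<noteq> {}" "T \<subseteq> {2..n}" "Max T < k + card T" "card T \<le> k" "finite T"
    using T finite_subset by (auto simp: partner_pair_iff)
  have "T \<subseteq> T \<inter> {..d} \<union> {d<..Max T}" using T' by (auto simp: not_le)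
  then have "card T \<le> card (T \<inter> {..d} \<union> {d<..Max T})" by (intro card_mono) auto
  also have "\<dots> \<le> card (T \<inter> {..d}) + (Max T - d)" by (rule card_Un_le[THEN order_trans]) simp
  finally have "card T \<le> card (T \<inter> {..d}) + (Max T - d)" .
  moreover have "d \<le> Max T" "card (T \<inter> {..d}) \<le> card T" using T' \<open>d \<in> T\<close> by (simp_all add: card_mono)
  ultimately have "d < k + card (T \<inter> {..d})" "card (T \<inter> {..d}) \<le> k" using T' by linarith+
  then show ?thesis using T' \<open>d \<in> T\<close> by (auto simp: partner_pair_iff Max_prefix)
qed

text \<open>An invariant of the neutral extensions of a resistant set.\<close>

definition dominant :: "nat set \<Rightarrow> bool"
  where "dominant U \<longleftrightarrow> finite U \<and> U \<noteq> {} \<and> (U = {2} \<or> U = {3} \<or> Max U < 2 * card U) \<and>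
    (\<forall>i. 4 \<le> i \<longrightarrow> i < 2 * card U \<longrightarrow> i < 2 * card (U \<inter> {..i}))"

text \<open>For \<open>Max T \<ge> 4\<close>, resistance at \<open>i = Max T\<close> gives
  \<open>Max T < 2 * card T\<close>; smaller maxima leave the exceptions \<open>{2}\<close> and
  \<open>{3}\<close>. Beyond \<open>Max T\<close> the set is complete and the second clause repeats
  its premise.\<close>

lemma resistant_dominant:
  assumes k: "3 \<le> k" "2 * k < n" and "resistant_pair n k S T"
  shows "dominant T"
proof (cases "T = {2, 3, 4}")
  case True
  have "{2, 3, 4} \<inter> {..i} = {2, 3, 4}" if "4 \<le> i" for i :: nat using that by auto
  then show ?thesis unfolding True dominant_def by simp
next
  case False
  have P: "partner_pair n k S T"
    and res: "\<forall>i\<in>{4..Max T}. i < 2 * card ((T - {Max T}) \<inter> {..i})"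
    using resistant_pair_iff[OF k] assms(3) False by blast+
  have T: "T \<noteq> {}" "T \<subseteq> {2..n}" using P by (simp_all add: partner_pair_iff)
  have finT: "finite T" using T(2) finite_subset by blast
  have le: "x \<le> Max T" if "x \<in> T" for x using that finT by simp
  have dom: "i < 2 * card (T \<inter> {..i})" if "4 \<le> i" "i < 2 * card T" for i
  proof (cases "i \<le> Max T")
    case True
    have "card ((T - {Max T}) \<inter> {..i}) \<le> card (T \<inter> {..i})" using finT by (intro card_mono) auto
    moreover have "i < 2 * card ((T - {Max T}) \<inter> {..i})" using res that(1) True by simp
    ultimately show ?thesis by linarith
  next
    case False
    then have "T \<inter> {..i} = T" using le by fastforce
    then show ?thesis using that by simp
  qed
  have "T = {2} \<or> T = {3} \<or> Max T < 2 * card T"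
  proof (cases "4 \<le> Max T")
    case True
    have "card ((T - {Max T}) \<inter> {..Max T}) \<le> card T" using finT by (intro card_mono) auto
    moreover have "Max T < 2 * card ((T - {Max T}) \<inter> {..Max T})" using res True by simp
    ultimately show ?thesis by linarith
  next
    case False
    have "x = 2 \<or> x = 3" if "x \<in> T" for x
    proof -
      have "2 \<le> x" using that T by auto
      then show ?thesis using False le[OF that] by linarith
    qed
    then have "T \<subseteq> {2, 3}" by blast
    then consider "T = {2}" | "T = {3}" | "T = {2, 3}"
      using T(1) by (cases "2 \<in> T"; cases "3 \<in> T") blast+
    then show ?thesis by cases simp_all
  qed
  then show ?thesis unfolding dominant_def using T(1) finT dom by (intro conjI allI impI)
qed

text \<open>Resistance discounts the maximum \<open>d\<close>, so it is a condition on
  \<open>U\<close> for indices up to \<open>d\<close>, a range covered by the invariant when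
  \<open>d < 2 * card U\<close>.\<close>

lemma dominant_insert_resistant:
  assumes k: "3 \<le> k" "2 * k < n" and "dominant U" "\<forall>x\<in>U. x < d" "d < 2 * card U"
    and T: "partner_pair n k (partner (insert d U)) (insert d U)"
  shows "resistant_pair n k (partner (insert d U)) (insert d U)"
proof -
  have fin: "finite U" using assms by (simp add: dominant_def)
  have M: "Max (insert d U) = d" using assms(4) fin by (intro Max_eqI) (auto intro: less_imp_le)
  have "insert d U - {d} = U" using assms(4) by auto
  moreover have "i < 2 * card (U \<inter> {..i})" if "4 \<le> i" "i \<le> d" for i
    using that assms by (auto simp: dominant_def)
  ultimately show ?thesis using T k by (simp add: resistant_pair_iff M)
qed

text \<open>The only new indices are \<open>2 * card U\<close> and its successor, and at both the
  enlarged set is already complete.\<close>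

lemma dominant_neutral_step:
  assumes "dominant U"
  shows "dominant (U \<union> {2 * card U})"
proof (cases "2 * card U \<in> U")
  case True
  then have "U \<union> {2 * card U} = U" by blast
  then show ?thesis using assms by (simp only:)
next
  case False
  let ?q = "2 * card U"
  let ?V = "insert ?q U"
  have U: "finite U" "U \<noteq> {}"
    and dom: "\<And>i. 4 \<le> i \<Longrightarrow> i < ?q \<Longrightarrow> i < 2 * card (U \<inter> {..i})"
    using assms by (simp_all add: dominant_def)
  have "U = {2} \<or> U = {3} \<or> Max U < ?q" using assms unfolding dominant_def by argo
  moreover have "U \<noteq> {2}" using False by auto
  ultimately consider "U = {3}" | "Max U < ?q" by blast
  then have "dominant ?V"
  proof cases
    case 1
    then show ?thesis by (auto simp: dominant_def)
  next
    case 2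
    have lt: "x < ?q" if "x \<in> U" for x using that 2 U Max_ge[of U x] by linarith
    have card: "card ?V = Suc (card U)" using False U by simp
    have "Max ?V = ?q" using lt U by (intro Max_eqI) (auto intro: less_imp_le)
    moreover have "i < 2 * card (?V \<inter> {..i})" if "4 \<le> i" "i < 2 * card ?V" for i
    proof (cases "i < ?q")
      case True
      have "card (U \<inter> {..i}) \<le> card (?V \<inter> {..i})" using U by (intro card_mono) auto
      then show ?thesis using dom[OF that(1) True] by linarith
    next
      case False
      then have "?V \<inter> {..i} = ?V" using lt by fastforce
      then show ?thesis using that by simp
    qed
    ultimately show ?thesis using U card unfolding dominant_def by simp
  qed
  then show ?thesis by simp
qed

lemma neutral_superset: "neutral R T \<Longrightarrow> R \<subseteq> T"
  by (induction rule: neutral.induct) auto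

lemma neutral_dominant: "neutral R T \<Longrightarrow> dominant R \<Longrightarrow> dominant T"
  by (induction rule: neutral.induct) (simp_all add: dominant_neutral_step del: Un_insert_right)

text \<open>The exceptional case \<^term>\<open>R = {3}\<close>, where \<^term>\<open>{2, 3}\<close> is neutral for \<^term>\<open>R\<close> although it
  precedes \<^term>\<open>R\<close>, has to be excluded.\<close>

lemma neutral_total_count:
  assumes "neutral R T" "dominant R" "R = {3} \<longrightarrow> 2 \<notin> T" "R \<subseteq> {2..n}" "2 * k < n"
    and "Max R < k + card R" "card T \<le> k"
  shows "partner_pair n k (partner T) T \<and> total_count n k T = total_count n k R"
  using assms
proof (induction)
  case base
  then show ?case by (auto simp: partner_pair_iff dominant_def)
next
  case (step U)
  have dom: "dominant U" and sub: "R \<subseteq> U"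
    using neutral_dominant neutral_superset step.hyps step.prems(1) by blast+
  have fin: "finite U" "U \<noteq> {}" using dom by (auto simp: dominant_def)
  have "card U \<le> card (U \<union> {2 * card U})" using fin by (intro card_mono) auto
  then have IH: "partner_pair n k (partner U) U" "total_count n k U = total_count n k R"
    using step by auto
  show ?case
  proof (cases "2 * card U \<in> U")
    \<comment> \<open>By the invariant this occurs only for \<open>U = {2}\<close>, where the step
      adds nothing.\<close>
    case True
    then show ?thesis using IH by (simp add: insert_absorb)
  next
    case False
    have "U \<noteq> {2}" using False by auto
    \<comment> \<open>The step from \<open>{3}\<close> would insert 2, which lies below the
      maximum.\<close>
    moreover have "U \<noteq> {3}"
    proof
      assume "U = {3}"
      then have "R = {3}" using sub step.prems(1) by (auto simp: dominant_def)
      then show False using step.prems(2) \<open>U = {3}\<close> by simp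
    qed
    ultimately have lt: "Max U < 2 * card U" using dom by (auto simp: dominant_def)
    let ?V = "insert (2 * card U) U"
    have c: "card ?V = Suc (card U)" using fin False by simp
    have M: "Max ?V = 2 * card U"
      using lt fin Max_ge[of U] by (intro Max_eqI) (auto intro: order_trans less_imp_le)
    have "card U < k" using step.prems(6) c by simp
    moreover have "card U > 0" using fin by (simp add: card_gt_0_iff)
    ultimately have "partner_pair n k (partner ?V) ?V"
      using IH(1) c M step.prems(4) by (auto simp: partner_pair_iff)
    moreover from this have "total_count n k ?V = total_count n k U"
      using fin lt by (intro total_count_neutral_step) auto
    ultimately show ?thesis using IH(2) by simp
  qed
qed

section \<open>Equality of counts and the longest resistant initial segment\<close>

lemma total_count_eq_iff_neutral:
  assumes k: "3 \<le> k" "2 * k < n" and T: "partner_pair n k (partner T) T"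
    and r: "r \<in> T" "resistant_pair n k (partner (T \<inter> {..r})) (T \<inter> {..r})"
    and longest: "\<And>d. d \<in> T \<Longrightarrow> resistant_pair n k (partner (T \<inter> {..d})) (T \<inter> {..d}) \<Longrightarrow> d \<le> r"
  shows "total_count n k T = total_count n k (T \<inter> {..r}) \<longleftrightarrow> neutral (T \<inter> {..r}) T"
proof -
  let ?R = "T \<inter> {..r}"
  have T': "T \<noteq> {}" "T \<subseteq> {2..n}" "card T \<le> k" "finite T"
    using T finite_subset by (auto simp: partner_pair_iff)
  have dom: "dominant ?R" using resistant_dominant[OF k r(2)] .
  have R: "Max ?R < k + card ?R" "?R \<subseteq> {2..n}"
    using partner_pair_prefix[OF T r(1)] by (auto simp: partner_pair_iff)
  \<comment> \<open>An initial segment equal to \<open>{3}\<close> shows that 2 was already absent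
    from \<open>T\<close>.\<close>
  have R3: "?R = {3} \<longrightarrow> 2 \<notin> T"
  proof
    assume "?R = {3}"
    moreover from this have "3 \<le> r" by auto
    moreover have "2 \<in> ?R" if "2 \<in> T" "3 \<le> r" using that by simp
    ultimately show "2 \<notin> T" by auto
  qed
  have eq: "total_count n k U = total_count n k ?R" if "neutral ?R U" "U \<subseteq> T" for U
  proof -
    have "card U \<le> k" using card_mono[OF T'(4) that(2)] T'(3) by linarith
    then show ?thesis using neutral_total_count[OF that(1) dom _ R(2) k(2) R(1)] R3 that(2) by blast
  qed
  have "neutral ?R T" if "total_count n k T = total_count n k ?R"
  proof (rule ccontr)
    assume not_neutral: "\<not> neutral ?R T"
    let ?D = "{d \<in> T. neutral ?R (T \<inter> {..d})}"
    define m where "m = Max ?D"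
    have D: "finite ?D" "r \<in> ?D" using T' r(1) neutral.base by auto
    then have "m \<in> ?D" unfolding m_def by (intro Max_in) auto
    then have m: "m \<in> T" "neutral ?R (T \<inter> {..m})" by auto
    have m_max: "d \<le> m" if "d \<in> ?D" for d using that D unfolding m_def by simp
    let ?U = "T \<inter> {..m}"
    have domU: "dominant ?U" using neutral_dominant[OF m(2) dom] .
    let ?E = "T \<inter> {m<..}"
    have "?E \<noteq> {}"
    proof
      assume "?E = {}"
      then have "?U = T" by (auto simp: not_le)
      then show False using m not_neutral by simp
    qed
    define d where "d = Min ?E"
    have "d \<in> ?E" unfolding d_def using \<open>?E \<noteq> {}\<close> T' by (intro Min_in) auto
    then have d: "d \<in> T" "m < d" by auto
    have dmin: "d \<le> x" if "x \<in> T" "m < x" for x unfolding d_def using that T' by simp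
    have pre: "T \<inter> {..d} = insert d ?U" using d dmin by force
    \<comment> \<open>Cutting just before \<open>d\<close> gives the same segment; the index
      \<open>d - 1\<close> is the one for which \<open>2 * card ?U < d\<close> yields a strict
      decrease.\<close>
    have pre': "?U = T \<inter> {..d - 1}" using d dmin by force
    consider "d = 2 * card ?U" | "d < 2 * card ?U" | "2 * card ?U < d" by linarith
    then show False
    proof cases
      case 1
      then have "neutral ?R (T \<inter> {..d})" using neutral.step[OF m(2)] pre by simp
      then show False using m_max[of d] d by simp
    next
      case 2
      have "resistant_pair n k (partner (insert d ?U)) (insert d ?U)"
        using partner_pair_prefix[OF T d(1)] 2 d
        by (intro dominant_insert_resistant[OF k domU]) (auto simp: pre)
      then have "d \<le> r" using longest[OF d(1)] pre by simp
      then show False using m_max[OF D(2)] d by simp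
    next
      case 3
      have "d - 1 < Max T" using T' d Max_ge[of T d] by linarith
      then have "total_count n k T < total_count n k ?U"
        using 3 m(1) by (intro total_count_prefix_less[OF k(2) T _ pre']) auto
      then show False using eq[OF m(2)] that by simp
    qed
  qed
  then show ?thesis using eq[of T] by blast
qed

text \<open>Let \<open>T \<inter> {..r}\<close> be the longest resistant initial segment; by
  leastness \<open>R\<close> does not come after it. If \<open>T\<close> first differs from
  \<open>R\<close> at \<open>d\<close>, then \<open>d > r\<close>. Either \<open>R\<close> ends
  before \<open>d\<close> and is itself an initial segment of \<open>T\<close>, or
  \<open>T \<inter> {..d}\<close> inherits resistance from \<open>R\<close> and is too long.\<close>

lemma least_resistant_is_longest_prefix:
  assumes k: "3 \<le> k" "2 * k < n" and T: "partner_pair n k (partner T) T"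
    and R: "resistant_pair n k (partner R) R" "lex_le T R"
    and least: "\<And>V. resistant_pair n k (partner V) V \<Longrightarrow> lex_le T V \<Longrightarrow> lex_le R V"
  obtains r where "r \<in> T" "R = T \<inter> {..r}"
    "\<And>d. d \<in> T \<Longrightarrow> resistant_pair n k (partner (T \<inter> {..d})) (T \<inter> {..d}) \<Longrightarrow> d \<le> r"
proof -
  have T': "T \<noteq> {}" "T \<subseteq> {2..n}" "finite T"
    using T finite_subset by (auto simp: partner_pair_iff)
  have R': "R \<noteq> {}" "R \<subseteq> {2..n}" "finite R"
    and res: "R = {2, 3, 4} \<or> (\<forall>i\<in>{4..Max R}. i < 2 * card ((R - {Max R}) \<inter> {..i}))"
    using R k finite_subset[of R "{2..n}"] by (auto simp: resistant_pair_iff partner_pair_iff)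
  have gt3: "3 < x" if "x \<in> X" "X \<inter> {2, 3} = {}" "X \<subseteq> {2..n}" for x X
  proof -
    have "2 \<le> x" "x \<noteq> 2" "x \<noteq> 3" using that by auto
    then show ?thesis by linarith
  qed
  \<comment> \<open>\<open>R\<close> meets \<open>{2, 3}\<close>: otherwise resistance at 4 would
    need three elements up to 4, where only 4 itself is available. If \<open>T\<close> missed both,
    \<open>R\<close> would precede it.\<close>
  have start: "T \<inter> {2, 3} \<noteq> {}"
  proof
    assume no: "T \<inter> {2, 3} = {}"
    have "R \<inter> {2, 3} \<noteq> {}"
    proof
      assume no': "R \<inter> {2, 3} = {}"
      have "Max R \<in> R" using R' by simp
      then have "4 \<le> Max R" using gt3[OF _ no' R'(2)] by fastforce
      moreover have "R \<noteq> {2, 3, 4}" using no' by auto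
      ultimately have "4 < 2 * card ((R - {Max R}) \<inter> {..4})" using res by simp
      moreover have "(R - {Max R}) \<inter> {..4} \<subseteq> {4}" using gt3[OF _ no' R'(2)] by fastforce
      then have "card ((R - {Max R}) \<inter> {..4}) \<le> card {4::nat}" by (intro card_mono) auto
      ultimately show False by simp
    qed
    then obtain y where y: "y \<in> R" "y \<le> 3" by auto
    have m: "Min R \<in> R" "Min R \<le> 3"
      using Min_in[OF R'(3,1)] order_trans[OF Min_le[OF R'(3) y(1)] y(2)] by blast+
    have "x \<notin> T" if "x \<le> Min R" for x
      using gt3[OF _ no T'(2), of x] that m(2) by linarith
    moreover have "x \<notin> R" if "x < Min R" for x
      using Min_le[OF R'(3), of x] that by linarith
    ultimately have "lex_less R T"
      unfolding lex_less_iff[OF R'(3) T'(3)] using m(1) by (intro exI[of _ "Min R"]) simp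
    then show False using R(2) lex_less_imp_not_lex_le R' T' by blast
  qed
  let ?D = "{d \<in> T. resistant_pair n k (partner (T \<inter> {..d})) (T \<inter> {..d})}"
  define r where "r = Max ?D"
  \<comment> \<open>Cutting \<open>T\<close> at 2 or 3 makes the condition on indices from 4 on
    vacuous.\<close>
  have "?D \<noteq> {}"
  proof -
    obtain d where d: "d \<in> T" "d \<in> {2, 3}" using start by blast
    then have "resistant_pair n k (partner (T \<inter> {..d})) (T \<inter> {..d})"
      using partner_pair_prefix[OF T d(1)] k by (auto simp: resistant_pair_iff Max_prefix)
    then show ?thesis using d by blast
  qed
  then have "r \<in> ?D" unfolding r_def using T' by (intro Max_in) auto
  then have r: "r \<in> T" "resistant_pair n k (partner (T \<inter> {..r})) (T \<inter> {..r})" by auto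
  have longest: "d \<le> r"
    if "d \<in> T" "resistant_pair n k (partner (T \<inter> {..d})) (T \<inter> {..d})" for d
    using that T' unfolding r_def by simp
  have le: "lex_le R (T \<inter> {..r})" using least[OF r(2) lex_le_prefix[OF T'(3)]] .
  have "R = T \<inter> {..r}"
  proof (cases "T = R")
    case True
    have "T \<inter> {..Max T} = T" using T' by auto
    moreover have "Max T \<in> T" using T' by simp
    ultimately have "Max T \<le> r" using longest[of "Max T"] R(1) True by simp
    then have "x \<le> r" if "x \<in> T" for x using Max_ge[OF T'(3) that] by linarith
    then show ?thesis using True by auto
  next
    case False
    then have "lex_less T R" using R(2) by (simp add: lex_le_def)
    then obtain d where d: "d \<in> T" "d \<notin> R" "\<forall>x<d. x \<in> T \<longleftrightarrow> x \<in> R"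
      using lex_less_iff[OF T'(3) R'(3)] by blast
    \<comment> \<open>Otherwise \<open>d\<close> would also be the first difference between the
      segment up to \<open>r\<close> and \<open>R\<close>, placing that segment before
      \<open>R\<close>.\<close>
    have "r < d"
    proof (rule ccontr)
      assume "\<not> r < d"
      then have "d \<in> T \<inter> {..r} \<and> d \<notin> R \<and> (\<forall>x<d. x \<in> T \<inter> {..r} \<longleftrightarrow> x \<in> R)"
        using d \<open>\<not> r < d\<close> by simp
      then have "lex_less (T \<inter> {..r}) R"
        unfolding lex_less_iff[OF finite_Int[OF disjI1[OF T'(3)]] R'(3)] by (rule exI)
      then show False using le lex_less_imp_not_lex_le[of "T \<inter> {..r}" R] R'(3) T'(3) by simp
    qed
    have mR: "Max R \<in> R" using R' by simp
    show ?thesis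
    proof (cases "Max R < d")
      case True
      have mT: "Max R \<in> T" using d(3) True mR by blast
      have "x \<in> R \<longleftrightarrow> x \<in> T \<inter> {..Max R}" for x
      proof (cases "x \<le> Max R")
        case True
        then show ?thesis using d(3) \<open>Max R < d\<close> by simp
      next
        case False
        then show ?thesis using Max_ge[OF R'(3), of x] by auto
      qed
      then have eqR: "R = T \<inter> {..Max R}" by blast
      then have "Max R \<le> r" using longest[OF mT] R(1) by simp
      moreover have "r \<in> R" using d(3) \<open>r < d\<close> r(1) by blast
      then have "r \<le> Max R" using R' by simp
      ultimately show ?thesis using eqR by simp
    next
      case False
      then have "d < Max R" using d(2) mR by (cases "d = Max R") simp_all
      \<comment> \<open>Below \<open>d\<close> the two sets agree, and \<open>d\<close> is
        discounted in \<open>T \<inter> {..d}\<close> as its maximum and absent from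
        \<open>R\<close>. So resistance of \<open>R\<close> at \<open>i \<le> d\<close>
        transfers.\<close>
      have "i < 2 * card ((T \<inter> {..d} - {Max (T \<inter> {..d})}) \<inter> {..i})" if "i \<in> {4..Max (T \<inter> {..d})}" for i
      proof -
        have i: "4 \<le> i" "i \<le> d" using that d(1) by (auto simp: Max_prefix)
        have "R \<noteq> {2, 3, 4}" using i \<open>d < Max R\<close> by auto
        then have "i < 2 * card ((R - {Max R}) \<inter> {..i})" using res i \<open>d < Max R\<close> by auto
        moreover have "x \<in> (R - {Max R}) \<inter> {..i} \<longleftrightarrow> x \<in> (T \<inter> {..d} - {d}) \<inter> {..i}" for x
        proof (cases "x < d")
          case True
          then show ?thesis using d(3) \<open>d < Max R\<close> by simp
        next
          case False
          then show ?thesis using d(2) i(2) by (cases "x = d") simp_all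
        qed
        then have "(R - {Max R}) \<inter> {..i} = (T \<inter> {..d} - {d}) \<inter> {..i}" by blast
        ultimately show ?thesis using d(1) by (simp add: Max_prefix)
      qed
      then have "resistant_pair n k (partner (T \<inter> {..d})) (T \<inter> {..d})"
        using partner_pair_prefix[OF T d(1)] k by (simp add: resistant_pair_iff)
      then show ?thesis using longest[OF d(1)] \<open>r < d\<close> by simp
    qed
  qed
  then show ?thesis using that r(1) longest by blast
qed

theorem theorem13:
  fixes n k m l :: nat
    and Ss Ts :: "nat \<Rightarrow> nat set"
    and S T :: "nat set"
  assumes "n > 2 * k" and "2 * k \<ge> 6"
    and "bij_betw (\<lambda>i. (Ss i, Ts i)) {1..m} {(S', T'). resistant_pair n k S' T'}"
    and "\<forall>i\<in>{1..m}. \<forall>j\<in>{1..m}. i < j \<longrightarrow> lex_less (Ts i) (Ts j)"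
    and "Ts 0 = {2..n}"
    and "partner_pair n k S T"
    and "l \<in> {1..m}"
    and "lex_less (Ts (l - 1)) T" and "lex_le T (Ts l)"
  shows "card (lex_family n S (k - 1)) + card (lex_family n T k)
           = card (lex_family n (Ss l) (k - 1)) + card (lex_family n (Ts l) k)
         \<longleftrightarrow> neutral (Ts l) T"
proof -
  have k: "3 \<le> k" "2 * k < n" using assms(1,2) by auto
  have res: "resistant_pair n k (Ss i) (Ts i)" if "i \<in> {1..m}" for i
    using bij_betwE[OF assms(3)] that by auto
  have fin: "finite (Ts i)" if "i \<in> {1..m}" for i
    using res[OF that] k finite_subset[of "Ts i" "{2..n}"]
    by (auto simp: resistant_pair_iff partner_pair_iff)
  have part: "Ss i = partner (Ts i)" if "i \<in> {1..m}" for i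
    using res[OF that] k by (auto simp: resistant_pair_iff partner_pair_iff)
  have S: "S = partner T" and finT: "finite T"
    using assms(6) finite_subset[of T "{2..n}"] by (auto simp: partner_pair_iff)
  have T: "partner_pair n k (partner T) T" using assms(6) S by simp
  have Rl: "resistant_pair n k (partner (Ts l)) (Ts l)" using res[OF assms(7)] part[OF assms(7)] by simp
  have least: "lex_le (Ts l) V" if V: "resistant_pair n k (partner V) V" "lex_le T V" for V
  proof -
    obtain i where i: "i \<in> {1..m}" "V = Ts i"
    proof -
      have "(partner V, V) \<in> (\<lambda>i. (Ss i, Ts i)) ` {1..m}"
        using bij_betw_imp_surj_on[OF assms(3)] V(1) by simp
      then show ?thesis using that by blast
    qed
    \<comment> \<open>Here \<open>1 \<le> i \<le> l - 1\<close>, so \<open>V\<close> is at or before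
      \<open>Ts (l - 1)\<close>, which strictly precedes \<open>T\<close>.\<close>
    have "\<not> i < l"
    proof
      assume "i < l"
      then have l: "l - 1 \<in> {1..m}" "i \<le> l - 1" using i assms(7) by auto
      then have "lex_less V (Ts (l - 1)) \<or> V = Ts (l - 1)" using i assms(4) by (cases "i = l - 1") auto
      then have "lex_less V T" using lex_less_trans[OF fin[OF i(1)] fin[OF l(1)] finT] assms(8) i by blast
      then show False using V(2) lex_less_imp_not_lex_le fin[OF i(1)] finT i(2) by blast
    qed
    then show ?thesis using i assms(4,7) unfolding lex_le_def by (metis linorder_neqE_nat)
  qed
  obtain r where r: "r \<in> T" "Ts l = T \<inter> {..r}"
    "\<And>d. d \<in> T \<Longrightarrow> resistant_pair n k (partner (T \<inter> {..d})) (T \<inter> {..d}) \<Longrightarrow> d \<le> r"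
    using least_resistant_is_longest_prefix[OF k T Rl assms(9) least] by blast
  have "total_count n k T = total_count n k (Ts l) \<longleftrightarrow> neutral (Ts l) T"
    using total_count_eq_iff_neutral[OF k T r(1) _ r(3)] Rl r(2) by simp
  then show ?thesis
    by (simp add: card_lex_family total_count_def S part[OF assms(7)])
qed

end
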